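(* Let $\theta\in[\frac12,1]$, let $0=t_0<\dots<t_K=T$ be a uniform time grid with step $\Delta t=t_{k+1}-t_k$, and let $u_0,\dots,u_{K-1}\in\mathbb R$. Let $(v_k)$ and $(w_k)$ solve, for $0\le k<K$, $$\frac{v_{k+1}-v_k}{\Delta t}-(A+C)(\theta v_{k+1}+(1-\theta)v_k)=A\bar y-N(\bar y),\qquad v_0=y_0-\bar y_0,$$ $$\frac{w_{k+1}-w_k}{\Delta t}-(A+C)(\theta w_{k+1}+(1-\theta)w_k)=0,\qquad (I+\Delta t(1-\theta)(A+C))w_0=F.$$ Then the first simplified Newton step $(d^{(1)}_k)_{0\le k\le K}$ for the $\theta$-scheme, i.e. the solution of $$\frac{d^{(1)}_{k+1}-d^{(1)}_k}{\Delta t}-(A+C)(\theta d^{(1)}_{k+1}+(1-\theta)d^{(1)}_k)=A\bar y-N(\bar y)+Fu_k\quad(0\le k<K),\qquad d^{(1)}_0=y_0-\bar y_0,$$ can be represented by $$d^{(1)}_k=v_k+\Delta t\sum_{j=0}^{k-1}w_{k-j}u_j,$$ where the sum vanishes for $k=0$.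
   Context: Setting: $T>0$; $V\hookrightarrow W\hookrightarrow H$ are real Hilbert spaces with dense continuous embeddings; $y_0\in W$, $F\in H$, $U=L^2(0,T)$. $Y,Z$ are Banach spaces with $Y\hookrightarrow L^2(0,T;V)\cap C([0,T],H)$ and $Z\hookrightarrow L^2(0,T;H)\times W$ (boundary conditions are included in the definition of $Y$). $A$ is a linear spatial operator, $N$ a nonlinear term, and $E:Y\times U\to Z$, $E(y,u)=(\partial_t y-Ay+N(y)-Fu,\;y(0)-y_0)$ is continuously Fréchet differentiable with $E_y(y,u)\in\mathcal L(Y,Z)$ invertible for all $(y,u)$. For every time-independent $\bar y\in Y$ the operator $A-N_y(\bar y)$ generates a strongly continuous semigroup on $H$. A linearization point $\bar y\in Y$, constant in time, $\bar y(t)=\bar y_0$ with $\bar y_0\in V$, is fixed, and $C:=-N_y(\bar y)$. The numbers $u_k$ are an interval-wise constant discretization of a control $u\in U$. The time-discrete problem for $(d^{(1)}_k)$ is understood to determine its solution uniquely. *)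

theory Defs
  imports "HOL-Analysis.Analysis"
begin

definition dense_embedding :: "('a::real_normed_vector \<Rightarrow> 'b::real_normed_vector) \<Rightarrow> bool" where
  "dense_embedding i \<longleftrightarrow> bounded_linear i \<and> inj i \<and> closure (range i) = UNIV"

text \<open>
  The library's Bochner integral is confined to second countable spaces. Separability of the Hilbert
  spaces is not assumed here, so strong (Bochner) measurability is spelled out.
\<close>

definition strongly_measurable :: "'a measure \<Rightarrow> ('a \<Rightarrow> 'b::real_normed_vector) \<Rightarrow> bool" where
  "strongly_measurable M f \<longleftrightarrow> (\<exists>s. (\<forall>n. simple_function M (s n)) \<and>
     (AE x in M. (\<lambda>n. s n x) \<longlonglongrightarrow> f x))"

text \<open>
  Elements of \<open>L\<^sup>2(0,T;X)\<close> are handled through representatives, up to equality almost everywhere.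
\<close>

definition L2_fun :: "real \<Rightarrow> (real \<Rightarrow> 'a::real_normed_vector) \<Rightarrow> bool" where
  "L2_fun T f \<longleftrightarrow> strongly_measurable (lebesgue_on {0..T}) f \<and>
     integrable (lebesgue_on {0..T}) (\<lambda>t. (norm (f t))\<^sup>2)"

definition L2_norm :: "real \<Rightarrow> (real \<Rightarrow> 'a::real_normed_vector) \<Rightarrow> real" where
  "L2_norm T f = sqrt (\<integral>t. (norm (f t))\<^sup>2 \<partial>(lebesgue_on {0..T}))"

definition linear_into_L2 ::
  "real \<Rightarrow> ('a::real_normed_vector \<Rightarrow> real \<Rightarrow> 'b::real_normed_vector) \<Rightarrow> bool" where
  "linear_into_L2 T e \<longleftrightarrow> (\<forall>x. L2_fun T (e x)) \<and>
     (\<forall>x y. AE t in lebesgue_on {0..T}. e (x + y) t = e x t + e y t) \<and>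
     (\<forall>c x. AE t in lebesgue_on {0..T}. e (c *\<^sub>R x) t = c *\<^sub>R e x t)"

definition bounded_linear_into_L2 ::
  "real \<Rightarrow> ('a::real_normed_vector \<Rightarrow> real \<Rightarrow> 'b::real_normed_vector) \<Rightarrow> bool" where
  "bounded_linear_into_L2 T e \<longleftrightarrow> linear_into_L2 T e \<and>
     (\<exists>B. \<forall>x. L2_norm T (e x) \<le> B * norm x)"

definition bounded_linear_into_C ::
  "real \<Rightarrow> ('a::real_normed_vector \<Rightarrow> real \<Rightarrow> 'b::real_normed_vector) \<Rightarrow> bool" where
  "bounded_linear_into_C T e \<longleftrightarrow> (\<forall>x. continuous_on {0..T} (e x)) \<and>
     (\<forall>x y. \<forall>t\<in>{0..T}. e (x + y) t = e x t + e y t) \<and>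
     (\<forall>c x. \<forall>t\<in>{0..T}. e (c *\<^sub>R x) t = c *\<^sub>R e x t) \<and>
     (\<exists>B. \<forall>x. \<forall>t\<in>{0..T}. norm (e x t) \<le> B * norm x)"

text \<open>
  \<open>repr\<close> identifies a Hilbert space type isometrically with \<open>L\<^sup>2(0,T)\<close>
  (a type cannot depend on \<open>T\<close>).
\<close>

definition is_L2_space :: "real \<Rightarrow> ('u::{real_inner,complete_space} \<Rightarrow> real \<Rightarrow> real) \<Rightarrow> bool" where
  "is_L2_space T repr \<longleftrightarrow> linear_into_L2 T repr \<and> (\<forall>u. L2_norm T (repr u) = norm u) \<and>
     (\<forall>f. L2_fun T f \<longrightarrow> (\<exists>u. AE t in lebesgue_on {0..T}. repr u t = f t))"

text \<open>
  \<open>Y \<hookrightarrow> L\<^sup>2(0,T;V) \<inter> C([0,T],H)\<close>: the same element of \<open>Y\<close> has a \<open>V\<close>-valued representative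
  \<open>yV y\<close> and a continuous \<open>H\<close>-valued one \<open>yH y\<close>, which agree under the embedding \<open>j\<close> of \<open>V\<close>
  into \<open>H\<close>.
\<close>

definition state_space_embedding ::
  "real \<Rightarrow> ('v::real_normed_vector \<Rightarrow> 'h::real_normed_vector) \<Rightarrow>
   ('y::real_normed_vector \<Rightarrow> real \<Rightarrow> 'v) \<Rightarrow> ('y \<Rightarrow> real \<Rightarrow> 'h) \<Rightarrow> bool" where
  "state_space_embedding T j yV yH \<longleftrightarrow>
     bounded_linear_into_L2 T yV \<and> bounded_linear_into_C T yH \<and>
     (\<forall>y. AE t in lebesgue_on {0..T}. j (yV y t) = yH y t) \<and>
     (\<forall>y. (\<forall>t\<in>{0..T}. yH y t = 0) \<longrightarrow> y = 0)"

definition residual_space_embedding ::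
  "real \<Rightarrow> ('z::real_normed_vector \<Rightarrow> real \<Rightarrow> 'h::real_normed_vector) \<Rightarrow>
   ('z \<Rightarrow> 'w::real_normed_vector) \<Rightarrow> bool" where
  "residual_space_embedding T zH zW \<longleftrightarrow>
     bounded_linear_into_L2 T zH \<and> bounded_linear zW \<and>
     (\<forall>z. (AE t in lebesgue_on {0..T}. zH z t = 0) \<and> zW z = 0 \<longrightarrow> z = 0)"

definition time_independent ::
  "real \<Rightarrow> ('v \<Rightarrow> 'h) \<Rightarrow> ('y \<Rightarrow> real \<Rightarrow> 'h) \<Rightarrow> 'y \<Rightarrow> 'v \<Rightarrow> bool" where
  "time_independent T j yH y c \<longleftrightarrow> (\<forall>t\<in>{0..T}. yH y t = j c)"

text \<open>
  \<open>g\<close> is the weak time derivative of the continuous function \<open>f\<close>: \<open>g\<close> is Bochner integrable and \<open>f\<close> is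
  its primitive. The gauge integral extends the Bochner integral, so the two coincide on such \<open>g\<close>.
\<close>

definition has_time_derivative ::
  "real \<Rightarrow> (real \<Rightarrow> 'h::real_normed_vector) \<Rightarrow> (real \<Rightarrow> 'h) \<Rightarrow> bool" where
  "has_time_derivative T f g \<longleftrightarrow> strongly_measurable (lebesgue_on {0..T}) g \<and>
     integrable (lebesgue_on {0..T}) (\<lambda>t. norm (g t)) \<and>
     (\<forall>t\<in>{0..T}. (g has_integral (f t - f 0)) {0..t})"

text \<open>
  Unbounded operators are given by a domain and a function, which is relevant on the domain only.
\<close>

definition linear_operator ::
  "'a::real_vector set \<Rightarrow> ('a \<Rightarrow> 'b::real_vector) \<Rightarrow> bool" where
  "linear_operator D A \<longleftrightarrow> subspace D \<and>
     (\<forall>x\<in>D. \<forall>y\<in>D. A (x + y) = A x + A y) \<and> (\<forall>c. \<forall>x\<in>D. A (c *\<^sub>R x) = c *\<^sub>R A x)"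

text \<open>
  An operator \<open>L\<close> with domain \<open>D\<close> in \<open>V\<close> and values in \<open>H\<close>, seen as an operator in \<open>H\<close>: its domain
  is \<open>j ` D\<close>, with \<open>j\<close> the embedding of \<open>V\<close> into \<open>H\<close>.
\<close>

definition op_in :: "('v \<Rightarrow> 'h) \<Rightarrow> ('v \<Rightarrow> 'h) \<Rightarrow> 'h \<Rightarrow> 'h" where
  "op_in j L x = L (inv j x)"

definition C0_semigroup :: "(real \<Rightarrow> 'h::real_normed_vector \<Rightarrow> 'h) \<Rightarrow> bool" where
  "C0_semigroup S \<longleftrightarrow> (\<forall>t\<ge>0. bounded_linear (S t)) \<and> (\<forall>x. S 0 x = x) \<and>
     (\<forall>s\<ge>0. \<forall>t\<ge>0. \<forall>x. S (s + t) x = S s (S t x)) \<and>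
     (\<forall>x. ((\<lambda>t. S t x) \<longlongrightarrow> x) (at_right 0))"

definition generates_C0_semigroup ::
  "'h::real_normed_vector set \<Rightarrow> ('h \<Rightarrow> 'h) \<Rightarrow> bool" where
  "generates_C0_semigroup D G \<longleftrightarrow> (\<exists>S. C0_semigroup S \<and>
     D = {x. \<exists>y. ((\<lambda>t. (S t x - x) /\<^sub>R t) \<longlongrightarrow> y) (at_right 0)} \<and>
     (\<forall>x\<in>D. ((\<lambda>t. (S t x - x) /\<^sub>R t) \<longlongrightarrow> G x) (at_right 0)))"

text \<open>
  \<open>E(y,u) = (\<partial>\<^sub>t y - A y + N(y) - F u, y(0) - y\<^sub>0)\<close>, where \<open>A\<close> and \<open>N\<close> act pointwise in time.
\<close>

definition is_state_equation ::
  "real \<Rightarrow> ('w::real_vector \<Rightarrow> 'h::real_normed_vector) \<Rightarrow> 'v set \<Rightarrow> ('v \<Rightarrow> 'h) \<Rightarrow> ('v \<Rightarrow> 'h) \<Rightarrow> 'h \<Rightarrow> 'w \<Rightarrow>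
   ('y \<Rightarrow> real \<Rightarrow> 'v) \<Rightarrow> ('y \<Rightarrow> real \<Rightarrow> 'h) \<Rightarrow> ('u \<Rightarrow> real \<Rightarrow> real) \<Rightarrow>
   ('z \<Rightarrow> real \<Rightarrow> 'h) \<Rightarrow> ('z \<Rightarrow> 'w) \<Rightarrow> ('y \<Rightarrow> 'u \<Rightarrow> 'z) \<Rightarrow> bool" where
  "is_state_equation T i D A N F y0 yV yH uR zH zW E \<longleftrightarrow>
     (\<forall>y u. \<exists>g. has_time_derivative T (yH y) g \<and>
        (AE t in lebesgue_on {0..T}. yV y t \<in> D \<and>
           zH (E y u) t = g t - A (yV y t) + N (yV y t) - uR u t *\<^sub>R F) \<and>
        i (zW (E y u)) = yH y 0 - i y0)"

text \<open>
  Continuous Frechet differentiability on \<open>Y \<times> U\<close>, together with bounded invertibility of all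
  partial derivatives \<open>E\<^sub>y(y,u) = E'(y,u)(\<cdot>,0)\<close>.
\<close>

definition C1_with_invertible_state_derivative ::
  "('y::real_normed_vector \<Rightarrow> 'u::real_normed_vector \<Rightarrow> 'z::real_normed_vector) \<Rightarrow> bool" where
  "C1_with_invertible_state_derivative E \<longleftrightarrow>
     (\<exists>E' :: 'y \<times> 'u \<Rightarrow> ('y \<times> 'u) \<Rightarrow>\<^sub>L 'z.
        continuous_on UNIV E' \<and>
        (\<forall>p. ((\<lambda>(y, u). E y u) has_derivative blinfun_apply (E' p)) (at p)) \<and>
        (\<forall>p. \<exists>R :: 'z \<Rightarrow>\<^sub>L 'y.
           (\<forall>z. blinfun_apply (E' p) (blinfun_apply R z, 0) = z) \<and>
           (\<forall>\<eta>. blinfun_apply R (blinfun_apply (E' p) (\<eta>, 0)) = \<eta>)))"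

text \<open>
  The \<open>\<theta>\<close>-scheme for \<open>x' - G x = r\<close>. Only the combinations to which \<open>G\<close> is applied are required
  to lie in its domain \<open>D\<close>.
\<close>

definition theta_scheme ::
  "'h::real_vector set \<Rightarrow> ('h \<Rightarrow> 'h) \<Rightarrow> real \<Rightarrow> real \<Rightarrow> nat \<Rightarrow> (nat \<Rightarrow> 'h) \<Rightarrow> (nat \<Rightarrow> 'h) \<Rightarrow> bool" where
  "theta_scheme D G \<theta> dt K r x \<longleftrightarrow>
     (\<forall>k<K. \<theta> *\<^sub>R x (Suc k) + (1 - \<theta>) *\<^sub>R x k \<in> D \<and>
        (x (Suc k) - x k) /\<^sub>R dt - G (\<theta> *\<^sub>R x (Suc k) + (1 - \<theta>) *\<^sub>R x k) = r k)"

text \<open>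
  \<open>(I + dt (1 - \<theta>) G) x = f\<close>. For \<open>\<theta> < 1\<close> the first conjunct says \<open>x \<in> D\<close>; for \<open>\<theta> = 1\<close> it is
  void and the equation reads \<open>x = f\<close> with \<open>f\<close> not necessarily in \<open>D\<close>.
\<close>

definition theta_initial ::
  "'h::real_vector set \<Rightarrow> ('h \<Rightarrow> 'h) \<Rightarrow> real \<Rightarrow> real \<Rightarrow> 'h \<Rightarrow> 'h \<Rightarrow> bool" where
  "theta_initial D G \<theta> dt f x \<longleftrightarrow>
     (1 - \<theta>) *\<^sub>R x \<in> D \<and> x + (dt * (1 - \<theta>)) *\<^sub>R G x = f"

end

theory Submission
  imports Defs
begin

text \<open>
  This is Duhamel's principle in discrete form. The triples \<open>(r, a, b)\<close> such that one step of the
  scheme with source \<open>r\<close> leads from \<open>a\<close> to \<open>b\<close> form a linear subspace, because the operator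
  \<open>G = A + C\<close> is linear on its domain (\<open>theta_steps_subspace\<close>).

  The initial condition imposed on \<open>w\<close> says that \<open>(F, 0, dt w\<^sub>1)\<close> is such a triple: starting from
  rest, a source \<open>F\<close> acting during a single step produces \<open>dt w\<^sub>1\<close> (\<open>impulse_step\<close>). In the equation
  for \<open>w\<^sub>1\<close> the explicit part is \<open>w\<^sub>0 + dt (1 - \<theta>) G w\<^sub>0 = F\<close>, so that \<open>w\<^sub>1 - dt G (\<theta> w\<^sub>1) = F\<close>.
  From then on the homogeneous scheme propagates the impulse, and the contribution of the source
  \<open>u\<^sub>j F\<close> acting in step \<open>j\<close> is \<open>dt u\<^sub>j w\<^sub>k\<^sub>-\<^sub>j\<close> at every later time \<open>k\<close>. Superposing these responses
  with \<open>v\<close> gives a solution of the full scheme with initial value \<open>v\<^sub>0\<close>, and uniqueness identifies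
  it with the Newton step.
\<close>

text \<open>
  Collecting source, old value and new value in one vector lets finite superpositions of steps be
  handled by closure of subspaces under sums.
\<close>

definition theta_steps ::
  "'h::real_vector set \<Rightarrow> ('h \<Rightarrow> 'h) \<Rightarrow> real \<Rightarrow> real \<Rightarrow> ('h \<times> 'h \<times> 'h) set" where
  "theta_steps D G \<theta> dt = {(r, a, b). \<theta> *\<^sub>R b + (1 - \<theta>) *\<^sub>R a \<in> D \<and>
     (b - a) /\<^sub>R dt - G (\<theta> *\<^sub>R b + (1 - \<theta>) *\<^sub>R a) = r}"

lemma theta_scheme_iff_steps:
  "theta_scheme D G \<theta> dt K r x \<longleftrightarrow> (\<forall>k<K. (r k, x k, x (Suc k)) \<in> theta_steps D G \<theta> dt)"
  by (simp add: theta_scheme_def theta_steps_def)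

lemma linear_operator_zero:
  assumes "linear_operator D G"
  shows "G 0 = 0"
proof -
  have "0 \<in> D" and "\<forall>c. \<forall>x\<in>D. G (c *\<^sub>R x) = c *\<^sub>R G x"
    using assms by (auto simp: linear_operator_def subspace_0)
  from this(2)[rule_format, OF this(1), of 0] show ?thesis by simp
qed

lemma theta_steps_subspace:
  assumes lin: "linear_operator D G"
  shows "subspace (theta_steps D G \<theta> dt)"
proof (rule subspaceI)
  show "0 \<in> theta_steps D G \<theta> dt"
    using lin linear_operator_zero[OF lin]
    by (simp add: theta_steps_def zero_prod_def linear_operator_def subspace_0)
next
  fix p q assume "p \<in> theta_steps D G \<theta> dt" "q \<in> theta_steps D G \<theta> dt"
  then obtain r a b s a' b' where p: "p = (r, a, b)" and q: "q = (s, a', b')"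
    and m: "\<theta> *\<^sub>R b + (1 - \<theta>) *\<^sub>R a \<in> D" "\<theta> *\<^sub>R b' + (1 - \<theta>) *\<^sub>R a' \<in> D"
    and r: "r = (b - a) /\<^sub>R dt - G (\<theta> *\<^sub>R b + (1 - \<theta>) *\<^sub>R a)"
    and s: "s = (b' - a') /\<^sub>R dt - G (\<theta> *\<^sub>R b' + (1 - \<theta>) *\<^sub>R a')"
    unfolding theta_steps_def by blast
  have eq: "\<theta> *\<^sub>R (b + b') + (1 - \<theta>) *\<^sub>R (a + a') =
      (\<theta> *\<^sub>R b + (1 - \<theta>) *\<^sub>R a) + (\<theta> *\<^sub>R b' + (1 - \<theta>) *\<^sub>R a')"
    by (simp add: scaleR_add_right)
  have "\<theta> *\<^sub>R (b + b') + (1 - \<theta>) *\<^sub>R (a + a') \<in> D"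
    unfolding eq using lin m by (simp add: linear_operator_def subspace_add)
  moreover have "G (\<theta> *\<^sub>R (b + b') + (1 - \<theta>) *\<^sub>R (a + a')) =
      G (\<theta> *\<^sub>R b + (1 - \<theta>) *\<^sub>R a) + G (\<theta> *\<^sub>R b' + (1 - \<theta>) *\<^sub>R a')"
    unfolding eq using lin m by (simp add: linear_operator_def)
  ultimately show "p + q \<in> theta_steps D G \<theta> dt"
    unfolding p q r s theta_steps_def by (simp add: scaleR_add_right scaleR_diff_right)
next
  fix c p assume "p \<in> theta_steps D G \<theta> dt"
  then obtain r a b where p: "p = (r, a, b)"
    and m: "\<theta> *\<^sub>R b + (1 - \<theta>) *\<^sub>R a \<in> D"
    and r: "r = (b - a) /\<^sub>R dt - G (\<theta> *\<^sub>R b + (1 - \<theta>) *\<^sub>R a)"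
    unfolding theta_steps_def by blast
  have eq: "\<theta> *\<^sub>R (c *\<^sub>R b) + (1 - \<theta>) *\<^sub>R (c *\<^sub>R a) = c *\<^sub>R (\<theta> *\<^sub>R b + (1 - \<theta>) *\<^sub>R a)"
    by (simp add: scaleR_add_right mult.commute)
  have "\<theta> *\<^sub>R (c *\<^sub>R b) + (1 - \<theta>) *\<^sub>R (c *\<^sub>R a) \<in> D"
    unfolding eq using lin m by (simp add: linear_operator_def subspace_scale)
  moreover have "G (\<theta> *\<^sub>R (c *\<^sub>R b) + (1 - \<theta>) *\<^sub>R (c *\<^sub>R a)) =
      c *\<^sub>R G (\<theta> *\<^sub>R b + (1 - \<theta>) *\<^sub>R a)"
    unfolding eq using lin m by (simp add: linear_operator_def)
  ultimately show "c *\<^sub>R p \<in> theta_steps D G \<theta> dt"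
    unfolding p r theta_steps_def
    by (simp add: scaleR_diff_right mult.commute)
qed

text \<open>
  Since \<open>(1 - \<theta>) w\<^sub>0 \<in> D\<close>, the implicit part \<open>\<theta> w\<^sub>1\<close> lies in \<open>D\<close> by itself, and the step from \<open>w\<^sub>0\<close> to
  \<open>w\<^sub>1\<close> can be split into an explicit part, which yields \<open>F\<close>, and an implicit part, which is a step
  from \<open>0\<close>.
\<close>

lemma impulse_step:
  assumes lin: "linear_operator D G" and dt: "dt \<noteq> 0"
    and init: "theta_initial D G \<theta> dt F w0"
    and step: "(0, w0, w1) \<in> theta_steps D G \<theta> dt"
  shows "(F, 0, dt *\<^sub>R w1) \<in> theta_steps D G \<theta> dt"
proof -
  have D: "subspace D"
    and add: "\<And>x y. x \<in> D \<Longrightarrow> y \<in> D \<Longrightarrow> G (x + y) = G x + G y"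
    and scale: "\<And>c x. x \<in> D \<Longrightarrow> G (c *\<^sub>R x) = c *\<^sub>R G x"
    using lin by (auto simp: linear_operator_def)
  have expl: "(1 - \<theta>) *\<^sub>R w0 \<in> D" and F: "w0 + (dt * (1 - \<theta>)) *\<^sub>R G w0 = F"
    using init by (auto simp: theta_initial_def)
  have mid: "\<theta> *\<^sub>R w1 + (1 - \<theta>) *\<^sub>R w0 \<in> D"
    and eq: "(w1 - w0) /\<^sub>R dt = G (\<theta> *\<^sub>R w1 + (1 - \<theta>) *\<^sub>R w0)"
    using step by (auto simp: theta_steps_def)
  have impl: "\<theta> *\<^sub>R w1 \<in> D"
    using subspace_diff[OF D mid expl] by simp
  have G0: "G ((1 - \<theta>) *\<^sub>R w0) = (1 - \<theta>) *\<^sub>R G w0"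
  proof (cases "\<theta> = 1")
    \<comment> \<open>The fully implicit scheme allows \<open>w\<^sub>0 \<notin> D\<close>, but then \<open>G w\<^sub>0\<close> only occurs with factor \<open>0\<close>.\<close>
    case True
    then show ?thesis using linear_operator_zero[OF lin] by simp
  next
    case False
    then have "w0 = (1 / (1 - \<theta>)) *\<^sub>R ((1 - \<theta>) *\<^sub>R w0)"
      by simp
    then have "w0 \<in> D" using subspace_scale[OF D expl] by metis
    then show ?thesis by (rule scale)
  qed
  have "w1 - w0 = dt *\<^sub>R ((w1 - w0) /\<^sub>R dt)"
    using dt by simp
  also have "\<dots> = dt *\<^sub>R (G (\<theta> *\<^sub>R w1) + (1 - \<theta>) *\<^sub>R G w0)"
    by (simp only: eq add[OF impl expl] G0)
  finally have "w1 - dt *\<^sub>R G (\<theta> *\<^sub>R w1) = w0 + (dt * (1 - \<theta>)) *\<^sub>R G w0"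
    by (simp add: scaleR_add_right algebra_simps)
  then have "w1 - dt *\<^sub>R G (\<theta> *\<^sub>R w1) = F" by (simp only: F)
  moreover have "\<theta> *\<^sub>R (dt *\<^sub>R w1) = dt *\<^sub>R (\<theta> *\<^sub>R w1)"
    by (simp add: mult.commute)
  ultimately show ?thesis
    using dt subspace_scale[OF D impl, of dt] scale[OF impl, of dt]
    by (simp add: theta_steps_def mult.commute)
qed

text \<open>
  In step \<open>k\<close> the impulses of the earlier steps evolve freely, while the impulse of step \<open>k\<close> itself
  starts from \<open>0\<close>; this is why the convolution sum gains exactly one term.
\<close>

lemma theta_scheme_duhamel:
  assumes lin: "linear_operator D G" and dt: "dt \<noteq> 0"
    and v: "theta_scheme D G \<theta> dt K r v"
    and w: "theta_scheme D G \<theta> dt K (\<lambda>_. 0) w"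
    and init: "theta_initial D G \<theta> dt F (w 0)"
  shows "theta_scheme D G \<theta> dt K (\<lambda>k. r k + u k *\<^sub>R F)
    (\<lambda>k. v k + dt *\<^sub>R (\<Sum>j<k. u j *\<^sub>R w (k - j)))"
  unfolding theta_scheme_iff_steps
proof (intro allI impI)
  fix k assume k: "k < K"
  let ?S = "theta_steps D G \<theta> dt"
  note S = theta_steps_subspace[OF lin, of \<theta> dt]
  have vk: "(r k, v k, v (Suc k)) \<in> ?S"
    using v k by (simp add: theta_scheme_iff_steps)
  have wk: "(0, w i, w (Suc i)) \<in> ?S" if "i < K" for i
    using w that by (simp add: theta_scheme_iff_steps)
  have "(F, 0, dt *\<^sub>R w 1) \<in> ?S"
    using impulse_step[OF lin dt init] wk[of 0] k by simp
  then have new: "u k *\<^sub>R (F, 0, dt *\<^sub>R w 1) \<in> ?S"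
    by (rule subspace_scale[OF S])
  have old: "(\<Sum>j<k. (dt * u j) *\<^sub>R (0, w (k - j), w (Suc k - j))) \<in> ?S"
  proof (intro subspace_sum[OF S] subspace_scale[OF S])
    fix j assume "j \<in> {..<k}"
    then show "(0, w (k - j), w (Suc k - j)) \<in> ?S"
      using wk[of "k - j"] k by (simp add: Suc_diff_le)
  qed
  have sum_eq: "(\<Sum>j<k. (dt * u j) *\<^sub>R (0, w (k - j), w (Suc k - j))) =
      (0, dt *\<^sub>R (\<Sum>j<k. u j *\<^sub>R w (k - j)), dt *\<^sub>R (\<Sum>j<k. u j *\<^sub>R w (Suc k - j)))"
    by (simp add: sum_prod scaleR_sum_right)
  show "(r k + u k *\<^sub>R F, v k + dt *\<^sub>R (\<Sum>j<k. u j *\<^sub>R w (k - j)),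
      v (Suc k) + dt *\<^sub>R (\<Sum>j<Suc k. u j *\<^sub>R w (Suc k - j))) \<in> ?S"
    using subspace_add[OF S vk subspace_add[OF S new old[unfolded sum_eq]]]
    by (simp add: scaleR_add_right algebra_simps)
qed

text \<open>
  Injectivity of the embedding makes the operator induced on \<open>j ` D\<close> well defined; this transports
  linearity from \<open>V\<close> to \<open>H\<close>, where the scheme is posed.
\<close>

lemma linear_operator_op_in:
  assumes L: "linear_operator D L" and j: "linear j" "inj j"
  shows "linear_operator (j ` D) (op_in j L)"
proof -
  have val: "op_in j L (j x) = L x" for x
    using j(2) by (simp add: op_in_def)
  have D: "subspace D"
    and add: "\<And>x y. x \<in> D \<Longrightarrow> y \<in> D \<Longrightarrow> L (x + y) = L x + L y"
    and scale: "\<And>c x. x \<in> D \<Longrightarrow> L (c *\<^sub>R x) = c *\<^sub>R L x"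
    using L by (auto simp: linear_operator_def)
  have "subspace (j ` D)"
    by (rule linear_subspace_image[OF j(1) D])
  then show ?thesis
    using add scale
    by (auto simp: linear_operator_def val linear_add[OF j(1), symmetric]
        linear_scale[OF j(1), symmetric])
qed

lemma linear_operator_add_linear:
  assumes "linear_operator D A" and "linear C"
  shows "linear_operator D (\<lambda>x. A x + C x)"
  using assms by (auto simp: linear_operator_def linear_add linear_scale scaleR_add_right)

theorem proposition3p7:
  fixes T :: real
    and iVW :: "'v::{real_inner,complete_space} \<Rightarrow> 'w::{real_inner,complete_space}"
    and iWH :: "'w \<Rightarrow> 'h::{real_inner,complete_space}"
    and iVH :: "'v \<Rightarrow> 'h"
    and y0 :: 'w and F :: 'h
    and uR :: "'u::{real_inner,complete_space} \<Rightarrow> real \<Rightarrow> real"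
    and yV :: "'y::banach \<Rightarrow> real \<Rightarrow> 'v" and yH :: "'y \<Rightarrow> real \<Rightarrow> 'h"
    and zH :: "'z::banach \<Rightarrow> real \<Rightarrow> 'h" and zW :: "'z \<Rightarrow> 'w"
    and domA :: "'v set" and A N :: "'v \<Rightarrow> 'h"
    and E :: "'y \<Rightarrow> 'u \<Rightarrow> 'z"
    and ybar :: 'y and ybar0 :: 'v
    and C :: "'v \<Rightarrow> 'h"
    and D :: "'h set" and AC :: "'h \<Rightarrow> 'h"
    and \<theta> dt :: real and K :: nat and t :: "nat \<Rightarrow> real"
    and u :: "nat \<Rightarrow> real" and v w d :: "nat \<Rightarrow> 'h"
  assumes "T > 0"
    and "dense_embedding iVW" and "dense_embedding iWH" and "iVH = iWH \<circ> iVW"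
    and "is_L2_space T uR"
    and "state_space_embedding T iVH yV yH"
    and "residual_space_embedding T zH zW"
    and "linear_operator domA A"
    and "is_state_equation T iWH domA A N F y0 yV yH uR zH zW E"
    and "C1_with_invertible_state_derivative E"
    and "\<And>y c. time_independent T iVH yH y c \<Longrightarrow> N differentiable (at c) \<and>
           generates_C0_semigroup (iVH ` domA)
             (op_in iVH (\<lambda>x. A x - frechet_derivative N (at c) x))"
    and "time_independent T iVH yH ybar ybar0"
    and "C = (\<lambda>x. - frechet_derivative N (at ybar0) x)"
    and "D = iVH ` domA" and "AC = op_in iVH (\<lambda>x. A x + C x)"
    and "1/2 \<le> \<theta>" and "\<theta> \<le> 1"
    and "t 0 = 0" and "t K = T"
    and "\<And>k. k < K \<Longrightarrow> t k < t (Suc k)" and "\<And>k. k < K \<Longrightarrow> t (Suc k) - t k = dt"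
    and "theta_scheme D AC \<theta> dt K (\<lambda>_. A ybar0 - N ybar0) v"
    and "v 0 = iWH y0 - iVH ybar0"
    and "theta_scheme D AC \<theta> dt K (\<lambda>_. 0) w"
    and "theta_initial D AC \<theta> dt F (w 0)"
    and "theta_scheme D AC \<theta> dt K (\<lambda>k. A ybar0 - N ybar0 + u k *\<^sub>R F) d"
    and "d 0 = iWH y0 - iVH ybar0"
    and unique: "\<And>d'. theta_scheme D AC \<theta> dt K (\<lambda>k. A ybar0 - N ybar0 + u k *\<^sub>R F) d' \<Longrightarrow>
           d' 0 = iWH y0 - iVH ybar0 \<Longrightarrow> (\<forall>k\<le>K. d' k = d k)"
  shows "\<forall>k\<le>K. d k = v k + dt *\<^sub>R (\<Sum>j<k. u j *\<^sub>R w (k - j))"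
proof -
  have j: "linear iVH" "inj iVH"
    using assms(2-4)
    by (auto simp: dense_embedding_def bounded_linear.linear linear_compose inj_compose)
  have "N differentiable (at ybar0)"
    using assms(11)[OF assms(12)] by blast
  then have "linear (frechet_derivative N (at ybar0))"
    by (rule linear_frechet_derivative)
  then have "linear C"
    unfolding assms(13) by (rule linear_compose_neg)
  then have lin: "linear_operator D AC"
    unfolding assms(14,15)
    by (intro linear_operator_op_in linear_operator_add_linear assms(8) j)
  \<comment> \<open>\<open>T > 0\<close> rules out \<open>K = 0\<close>, and the first step gives \<open>dt = t\<^sub>1 - t\<^sub>0 > 0\<close>.\<close>
  have "K > 0"
    using assms(1,18,19) by (cases K) auto
  then have "dt \<noteq> 0"
    using assms(20)[of 0] assms(21)[of 0] by simp
  then have "theta_scheme D AC \<theta> dt K (\<lambda>k. A ybar0 - N ybar0 + u k *\<^sub>R F)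
      (\<lambda>k. v k + dt *\<^sub>R (\<Sum>j<k. u j *\<^sub>R w (k - j)))"
    by (rule theta_scheme_duhamel[OF lin _ assms(22,24,25)])
  from unique[OF this] show ?thesis
    using assms(23) by simp
qed

end
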